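(* Let $\mathsf C$ be an abelian category, let $A$ be an object of $\mathsf C$, let $n\in\mathbb N$ (with $0\in\mathbb N$), and let \[0\to K\to P_{n-1}\to P_{n-2}\to\cdots\to P_1\to P_0\to A\to 0\] and \[0\to L\to Q_{n-1}\to Q_{n-2}\to\cdots\to Q_1\to Q_0\to A\to 0\] be exact sequences in $\mathsf C$ where $P_i$ and $Q_i$ are projective for every $i\in[0,n-1]$. Then \[K\oplus Q_{n-1}\oplus P_{n-2}\oplus Q_{n-3}\oplus\cdots\oplus P_0\cong L\oplus P_{n-1}\oplus Q_{n-2}\oplus P_{n-3}\oplus\cdots\oplus Q_0\] if $n$ is even, and \[K\oplus Q_{n-1}\oplus P_{n-2}\oplus Q_{n-3}\oplus\cdots\oplus Q_0\cong L\oplus P_{n-1}\oplus Q_{n-2}\oplus P_{n-3}\oplus\cdots\oplus P_0\] if $n$ is odd.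
   Context: In the direct sums, besides $K$ (resp. $L$), there is exactly one summand for each index $i\in[0,n-1]$, with $P$ and $Q$ alternating: on the left-hand side the summand with index $n-1$ is $Q_{n-1}$, on the right-hand side it is $P_{n-1}$. For $n=0$ the sequences are $0\to K\to A\to 0$ and $0\to L\to A\to 0$, and the conclusion is $K\cong L$. The category $\mathsf C$ is not assumed to have enough projectives. *)

theory Defs
  imports "HOL-Algebra.Group"
begin

section \<open>Categories\<close>

record ('o, 'm) cat =
  Obj :: "'o set"
  Arr :: "'m set"
  Dom :: "'m \<Rightarrow> 'o"
  Cod :: "'m \<Rightarrow> 'o"
  Ide :: "'o \<Rightarrow> 'm"
  Cmp :: "'m \<Rightarrow> 'm \<Rightarrow> 'm" (infixr "\<cdot>\<index>" 75)

definition homset :: "('o, 'm, 'x) cat_scheme \<Rightarrow> 'o \<Rightarrow> 'o \<Rightarrow> 'm set" where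
  "homset C X Y = {f \<in> Arr C. Dom C f = X \<and> Cod C f = Y}"

locale category =
  fixes C :: "('o, 'm, 'x) cat_scheme" (structure)
  assumes Dom_closed: "f \<in> Arr C \<Longrightarrow> Dom C f \<in> Obj C"
    and Cod_closed: "f \<in> Arr C \<Longrightarrow> Cod C f \<in> Obj C"
    and Ide_closed: "X \<in> Obj C \<Longrightarrow> Ide C X \<in> homset C X X"
    and Cmp_closed: "\<lbrakk>f \<in> homset C X Y; g \<in> homset C Y Z\<rbrakk> \<Longrightarrow> g \<cdot> f \<in> homset C X Z"
    and Ide_left: "f \<in> homset C X Y \<Longrightarrow> Ide C Y \<cdot> f = f"
    and Ide_right: "f \<in> homset C X Y \<Longrightarrow> f \<cdot> Ide C X = f"
    and Cmp_assoc: "\<lbrakk>f \<in> homset C W X; g \<in> homset C X Y; h \<in> homset C Y Z\<rbrakk>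
      \<Longrightarrow> (h \<cdot> g) \<cdot> f = h \<cdot> (g \<cdot> f)"

definition monic :: "('o, 'm, 'x) cat_scheme \<Rightarrow> 'm \<Rightarrow> bool" where
  "monic C f \<longleftrightarrow> f \<in> Arr C \<and>
     (\<forall>X. \<forall>u \<in> homset C X (Dom C f). \<forall>v \<in> homset C X (Dom C f).
        f \<cdot>\<^bsub>C\<^esub> u = f \<cdot>\<^bsub>C\<^esub> v \<longrightarrow> u = v)"

definition epic :: "('o, 'm, 'x) cat_scheme \<Rightarrow> 'm \<Rightarrow> bool" where
  "epic C f \<longleftrightarrow> f \<in> Arr C \<and>
     (\<forall>Y. \<forall>u \<in> homset C (Cod C f) Y. \<forall>v \<in> homset C (Cod C f) Y.
        u \<cdot>\<^bsub>C\<^esub> f = v \<cdot>\<^bsub>C\<^esub> f \<longrightarrow> u = v)"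

definition isomorphic :: "('o, 'm, 'x) cat_scheme \<Rightarrow> 'o \<Rightarrow> 'o \<Rightarrow> bool" where
  "isomorphic C X Y \<longleftrightarrow> X \<in> Obj C \<and> Y \<in> Obj C \<and>
     (\<exists>f \<in> homset C X Y. \<exists>g \<in> homset C Y X. g \<cdot>\<^bsub>C\<^esub> f = Ide C X \<and> f \<cdot>\<^bsub>C\<^esub> g = Ide C Y)"

definition zero_object :: "('o, 'm, 'x) cat_scheme \<Rightarrow> 'o \<Rightarrow> bool" where
  "zero_object C Z \<longleftrightarrow> Z \<in> Obj C \<and>
     (\<forall>X \<in> Obj C. (\<exists>!f. f \<in> homset C X Z) \<and> (\<exists>!f. f \<in> homset C Z X))"

definition projective :: "('o, 'm, 'x) cat_scheme \<Rightarrow> 'o \<Rightarrow> bool" where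
  "projective C P \<longleftrightarrow> P \<in> Obj C \<and>
     (\<forall>e f. epic C e \<and> f \<in> homset C P (Cod C e) \<longrightarrow>
        (\<exists>g \<in> homset C P (Dom C e). e \<cdot>\<^bsub>C\<^esub> g = f))"

section \<open>Preadditive categories\<close>

record ('o, 'm) add_cat = "('o, 'm) cat" +
  Add :: "'m \<Rightarrow> 'm \<Rightarrow> 'm"
  Zer :: "'o \<Rightarrow> 'o \<Rightarrow> 'm"

definition hom_group :: "('o, 'm, 'x) add_cat_scheme \<Rightarrow> 'o \<Rightarrow> 'o \<Rightarrow> 'm monoid" where
  "hom_group C X Y = \<lparr>carrier = homset C X Y, mult = Add C, one = Zer C X Y\<rparr>"

locale preadditive_category = category C
  for C :: "('o, 'm, 'x) add_cat_scheme" (structure) +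
  assumes hom_comm_group: "\<lbrakk>X \<in> Obj C; Y \<in> Obj C\<rbrakk> \<Longrightarrow> comm_group (hom_group C X Y)"
    and Cmp_Add: "\<lbrakk>f \<in> homset C X Y; g \<in> homset C X Y; h \<in> homset C Y Z\<rbrakk>
      \<Longrightarrow> h \<cdot> Add C f g = Add C (h \<cdot> f) (h \<cdot> g)"
    and Add_Cmp: "\<lbrakk>e \<in> homset C W X; f \<in> homset C X Y; g \<in> homset C X Y\<rbrakk>
      \<Longrightarrow> Add C f g \<cdot> e = Add C (f \<cdot> e) (g \<cdot> e)"

definition is_kernel :: "('o, 'm, 'x) add_cat_scheme \<Rightarrow> 'm \<Rightarrow> 'm \<Rightarrow> bool" where
  "is_kernel C f k \<longleftrightarrow> f \<in> Arr C \<and> k \<in> Arr C \<and> Cod C k = Dom C f \<and>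
     f \<cdot>\<^bsub>C\<^esub> k = Zer C (Dom C k) (Cod C f) \<and>
     (\<forall>h \<in> Arr C. Cod C h = Dom C f \<and> f \<cdot>\<^bsub>C\<^esub> h = Zer C (Dom C h) (Cod C f) \<longrightarrow>
        (\<exists>!u. u \<in> homset C (Dom C h) (Dom C k) \<and> k \<cdot>\<^bsub>C\<^esub> u = h))"

definition is_cokernel :: "('o, 'm, 'x) add_cat_scheme \<Rightarrow> 'm \<Rightarrow> 'm \<Rightarrow> bool" where
  "is_cokernel C f c \<longleftrightarrow> f \<in> Arr C \<and> c \<in> Arr C \<and> Dom C c = Cod C f \<and>
     c \<cdot>\<^bsub>C\<^esub> f = Zer C (Dom C f) (Cod C c) \<and>
     (\<forall>h \<in> Arr C. Dom C h = Cod C f \<and> h \<cdot>\<^bsub>C\<^esub> f = Zer C (Dom C f) (Cod C h) \<longrightarrow>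
        (\<exists>!u. u \<in> homset C (Cod C c) (Cod C h) \<and> u \<cdot>\<^bsub>C\<^esub> c = h))"

definition is_biproduct :: "('o, 'm, 'x) add_cat_scheme \<Rightarrow> 'o \<Rightarrow> 'o \<Rightarrow> 'o \<Rightarrow> bool" where
  "is_biproduct C X Y S \<longleftrightarrow>
     (\<exists>i \<in> homset C X S. \<exists>j \<in> homset C Y S. \<exists>p \<in> homset C S X. \<exists>q \<in> homset C S Y.
        p \<cdot>\<^bsub>C\<^esub> i = Ide C X \<and> q \<cdot>\<^bsub>C\<^esub> j = Ide C Y \<and>
        p \<cdot>\<^bsub>C\<^esub> j = Zer C Y X \<and> q \<cdot>\<^bsub>C\<^esub> i = Zer C X Y \<and>
        Add C (i \<cdot>\<^bsub>C\<^esub> p) (j \<cdot>\<^bsub>C\<^esub> q) = Ide C S)"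

section \<open>Abelian categories\<close>

locale abelian_category = preadditive_category C
  for C :: "('o, 'm, 'x) add_cat_scheme" (structure) +
  assumes ex_zero_object: "\<exists>Z. zero_object C Z"
    and ex_biproduct: "\<lbrakk>X \<in> Obj C; Y \<in> Obj C\<rbrakk> \<Longrightarrow> \<exists>S. is_biproduct C X Y S"
    and ex_kernel: "f \<in> Arr C \<Longrightarrow> \<exists>k. is_kernel C f k"
    and ex_cokernel: "f \<in> Arr C \<Longrightarrow> \<exists>c. is_cokernel C f c"
    and monic_is_kernel: "monic C k \<Longrightarrow> \<exists>f. is_kernel C f k"
    and epic_is_cokernel: "epic C c \<Longrightarrow> \<exists>f. is_cokernel C f c"

text \<open>
  In an abelian category the direct sum of two objects exists and is unique up to isomorphism;
  the function biprod picks one. Longer direct sums are bracketed to the right, and the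
  direct sum of a single object is that object itself.
\<close>

definition biprod :: "('o, 'm, 'x) add_cat_scheme \<Rightarrow> 'o \<Rightarrow> 'o \<Rightarrow> 'o" where
  "biprod C X Y = (SOME S. is_biproduct C X Y S)"

fun direct_sum :: "('o, 'm, 'x) add_cat_scheme \<Rightarrow> 'o list \<Rightarrow> 'o" where
  "direct_sum C [] = (SOME Z. zero_object C Z)"
| "direct_sum C [X] = X"
| "direct_sum C (X # Y # Ys) = biprod C X (direct_sum C (Y # Ys))"

section \<open>Exact sequences\<close>

definition is_image :: "('o, 'm, 'x) add_cat_scheme \<Rightarrow> 'm \<Rightarrow> 'm \<Rightarrow> bool" where
  "is_image C f m \<longleftrightarrow> (\<exists>c. is_cokernel C f c \<and> is_kernel C c m)"

text \<open>
  Images and kernels are subobjects, i.e. monomorphisms up to isomorphism, so they agree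
  when some monomorphism represents both.
\<close>

definition exact_at :: "('o, 'm, 'x) add_cat_scheme \<Rightarrow> 'm \<Rightarrow> 'm \<Rightarrow> bool" where
  "exact_at C f g \<longleftrightarrow> Cod C f = Dom C g \<and> (\<exists>m. is_image C f m \<and> is_kernel C g m)"

definition exact_sequence :: "('o, 'm, 'x) add_cat_scheme \<Rightarrow> 'o list \<Rightarrow> 'm list \<Rightarrow> bool" where
  "exact_sequence C Xs fs \<longleftrightarrow> length Xs = Suc (length fs) \<and>
     (\<forall>i < length fs. fs ! i \<in> homset C (Xs ! i) (Xs ! Suc i)) \<and>
     (\<forall>i. Suc i < length fs \<longrightarrow> exact_at C (fs ! i) (fs ! Suc i))"

end

theory Submission
  imports Defs
begin

text \<open>
  This is the generalized Schanuel lemma. Cutting the two long sequences at the images of their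
  arrows gives short exact sequences \<open>S (i+1) \<rightarrow> P i \<rightarrow> S i\<close> and \<open>T (i+1) \<rightarrow> Q i \<rightarrow> T i\<close>, where \<open>S 0\<close> and
  \<open>T 0\<close> are isomorphic to \<open>A\<close>, while \<open>S n\<close> and \<open>T n\<close> are isomorphic to \<open>K\<close> and \<open>L\<close>
  (lemma \<open>exact_sequence_syzygies\<close>).

  The proof goes by induction along the syzygies, from \<open>A\<close> towards \<open>K\<close> and \<open>L\<close>. Suppose that
  \<open>S n \<oplus> E\<close> and \<open>T n \<oplus> F\<close> are isomorphic, with \<open>E\<close> and \<open>F\<close> projective. Adding \<open>E\<close> to the middle and
  right terms of the next short exact sequence leaves the kernel unchanged
  (\<open>short_exact_add_summand\<close>), so \<open>S (n+1) \<rightarrow> P n \<oplus> E\<close> and \<open>T (n+1) \<rightarrow> Q n \<oplus> F\<close> are kernels of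
  epimorphisms from projective objects onto the same object. The ordinary Schanuel lemma
  (\<open>Schanuel\<close>) then gives \<open>S (n+1) \<oplus> (Q n \<oplus> F) \<cong> T (n+1) \<oplus> (P n \<oplus> E)\<close>, which is the claim for
  \<open>n+1\<close>: the crossing over of \<open>P n\<close> and \<open>Q n\<close> is what makes the summands alternate.

  The ordinary Schanuel lemma for epimorphisms \<open>a : P \<rightarrow> B\<close> and \<open>b : Q \<rightarrow> B\<close> is obtained without
  pullbacks: the kernel of \<open>(a, b) : P \<oplus> Q \<rightarrow> B\<close> is \<open>ker a \<oplus> Q\<close>, because a lift of \<open>b\<close> along
  \<open>a\<close> gives a shear of \<open>P \<oplus> Q\<close> that turns \<open>(a, b)\<close> into \<open>(a, 0)\<close>; by symmetry it is also
  \<open>ker b \<oplus> P\<close>.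
\<close>

section \<open>Arrows in preadditive categories\<close>

context category
begin

text \<open>
  Equations between arrows are proved by rewriting. To make typing conditions decidable for the
  simplifier, the axioms are restated with conditions on domains and codomains in place of
  membership in hom-sets, whose end points the simplifier would have to guess.
\<close>
lemma Cmp_simps [simp]:
  assumes "f \<in> Arr C" "g \<in> Arr C" "Dom C g = Cod C f"
  shows "g \<cdot> f \<in> Arr C" "Dom C (g \<cdot> f) = Dom C f" "Cod C (g \<cdot> f) = Cod C g"
  using assms Cmp_closed [of f "Dom C f" "Cod C f" g "Cod C g"] by (auto simp: homset_def)

lemma Ide_simps [simp]:
  assumes "X \<in> Obj C"
  shows "Ide C X \<in> Arr C" "Dom C (Ide C X) = X" "Cod C (Ide C X) = X"
  using Ide_closed [OF assms] by (auto simp: homset_def)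

lemma Ide_Cmp [simp]: "\<lbrakk>f \<in> Arr C; Cod C f = X\<rbrakk> \<Longrightarrow> Ide C X \<cdot> f = f"
  using Ide_left [of f "Dom C f" X] by (auto simp: homset_def)

lemma Cmp_Ide [simp]: "\<lbrakk>f \<in> Arr C; Dom C f = X\<rbrakk> \<Longrightarrow> f \<cdot> Ide C X = f"
  using Ide_right [of f X "Cod C f"] by (auto simp: homset_def)

lemma Cmp_Cmp [simp]:
  "\<lbrakk>f \<in> Arr C; g \<in> Arr C; h \<in> Arr C; Dom C g = Cod C f; Dom C h = Cod C g\<rbrakk>
    \<Longrightarrow> (h \<cdot> g) \<cdot> f = h \<cdot> (g \<cdot> f)"
  using Cmp_assoc [of f "Dom C f" "Cod C f" g "Cod C g" h "Cod C h"] by (auto simp: homset_def)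

lemma Dom_Cod_Obj [simp]:
  "f \<in> Arr C \<Longrightarrow> Dom C f \<in> Obj C" "f \<in> Arr C \<Longrightarrow> Cod C f \<in> Obj C"
  by (fact Dom_closed Cod_closed)+

text \<open>
  Composites are normalized by bracketing to the right, which hides a redex \<open>g \<cdot> f\<close> inside
  \<open>g \<cdot> (f \<cdot> h)\<close>. This lemma turns an equation for \<open>g \<cdot> f\<close> into one that still applies there.
\<close>
lemma Cmp_reassoc:
  assumes "g \<cdot> f = x" "f \<in> Arr C" "g \<in> Arr C" "h \<in> Arr C" "Dom C g = Cod C f" "Dom C f = Cod C h"
  shows "g \<cdot> (f \<cdot> h) = x \<cdot> h"
  using assms by (metis Cmp_Cmp)

lemma monicD:
  assumes "monic C f" "f \<cdot> u = f \<cdot> v"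
    "u \<in> Arr C" "v \<in> Arr C" "Dom C u = Dom C v" "Cod C u = Dom C f" "Cod C v = Dom C f"
  shows "u = v"
  using assms unfolding monic_def homset_def by simp

lemma epicD:
  assumes "epic C f" "u \<cdot> f = v \<cdot> f"
    "u \<in> Arr C" "v \<in> Arr C" "Cod C u = Cod C v" "Dom C u = Cod C f" "Dom C v = Cod C f"
  shows "u = v"
  using assms unfolding epic_def homset_def by simp

lemma monic_Cmp:
  assumes "monic C f" "monic C g" "Dom C g = Cod C f"
  shows "monic C (g \<cdot> f)"
proof -
  have [simp]: "f \<in> Arr C" "g \<in> Arr C" using assms by (auto simp: monic_def)
  show ?thesis
    unfolding monic_def
  proof (intro conjI allI ballI impI)
    fix X u v
    assume "u \<in> homset C X (Dom C (g \<cdot> f))" "v \<in> homset C X (Dom C (g \<cdot> f))"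
      and eq: "(g \<cdot> f) \<cdot> u = (g \<cdot> f) \<cdot> v"
    then have [simp]: "u \<in> Arr C" "v \<in> Arr C" "Dom C u = X" "Dom C v = X"
        "Cod C u = Dom C f" "Cod C v = Dom C f"
      using assms(3) by (auto simp: homset_def)
    have "f \<cdot> u = f \<cdot> v"
      by (rule monicD [OF assms(2)]) (use eq assms(3) in simp_all)
    then show "u = v"
      by (rule monicD [OF assms(1)]) simp_all
  qed (use assms(3) in simp)
qed

lemma isomorphicI:
  assumes "f \<in> Arr C" "g \<in> Arr C" "Dom C f = X" "Cod C f = Y" "Dom C g = Y" "Cod C g = X"
    "g \<cdot> f = Ide C X" "f \<cdot> g = Ide C Y"
  shows "isomorphic C X Y"
  using assms unfolding isomorphic_def homset_def by auto

lemma isomorphicE: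
  assumes "isomorphic C X Y"
  obtains f g where "f \<in> Arr C" "g \<in> Arr C" "Dom C f = X" "Cod C f = Y" "Dom C g = Y" "Cod C g = X"
    "g \<cdot> f = Ide C X" "f \<cdot> g = Ide C Y"
  using assms unfolding isomorphic_def homset_def by auto

lemma isomorphic_sym: "isomorphic C X Y \<Longrightarrow> isomorphic C Y X"
  unfolding isomorphic_def by blast

lemma isomorphic_trans:
  assumes "isomorphic C X Y" "isomorphic C Y W"
  shows "isomorphic C X W"
proof -
  from assms(1) obtain f g where [simp]: "f \<in> Arr C" "g \<in> Arr C" "Dom C f = X" "Cod C f = Y"
    "Dom C g = Y" "Cod C g = X" and gf: "g \<cdot> f = Ide C X" "f \<cdot> g = Ide C Y"
    by (rule isomorphicE)
  from assms(2) obtain f' g' where [simp]: "f' \<in> Arr C" "g' \<in> Arr C" "Dom C f' = Y" "Cod C f' = W"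
    "Dom C g' = W" "Cod C g' = Y" and gf': "g' \<cdot> f' = Ide C Y" "f' \<cdot> g' = Ide C W"
    by (rule isomorphicE)
  show ?thesis
    by (rule isomorphicI [of "f' \<cdot> f" "g \<cdot> g'"])
      (simp_all add: gf gf' Cmp_reassoc [OF gf'(1)] Cmp_reassoc [OF gf(2)])
qed

end

context preadditive_category
begin

lemma Zer_simps [simp]:
  assumes "X \<in> Obj C" "Y \<in> Obj C"
  shows "Zer C X Y \<in> Arr C" "Dom C (Zer C X Y) = X" "Cod C (Zer C X Y) = Y"
proof -
  interpret G: comm_group "hom_group C X Y" by (rule hom_comm_group [OF assms])
  from G.one_closed show "Zer C X Y \<in> Arr C" "Dom C (Zer C X Y) = X" "Cod C (Zer C X Y) = Y"
    by (auto simp: hom_group_def homset_def)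
qed

lemma Add_simps [simp]:
  assumes "f \<in> Arr C" "g \<in> Arr C" "Dom C g = Dom C f" "Cod C g = Cod C f"
  shows "Add C f g \<in> Arr C" "Dom C (Add C f g) = Dom C f" "Cod C (Add C f g) = Cod C f"
proof -
  interpret G: comm_group "hom_group C (Dom C f) (Cod C f)"
    by (rule hom_comm_group) (use assms in auto)
  from G.m_closed [of f g] assms
  show "Add C f g \<in> Arr C" "Dom C (Add C f g) = Dom C f" "Cod C (Add C f g) = Cod C f"
    by (auto simp: hom_group_def homset_def)
qed

lemma Add_assoc [simp]:
  assumes "f \<in> Arr C" "g \<in> Arr C" "h \<in> Arr C"
    "Dom C g = Dom C f" "Cod C g = Cod C f" "Dom C h = Dom C f" "Cod C h = Cod C f"
  shows "Add C (Add C f g) h = Add C f (Add C g h)"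
proof -
  interpret G: comm_group "hom_group C (Dom C f) (Cod C f)"
    by (rule hom_comm_group) (use assms in auto)
  from G.m_assoc [of f g h] assms show ?thesis
    by (auto simp: hom_group_def homset_def)
qed

lemma Add_commute:
  assumes "f \<in> Arr C" "g \<in> Arr C" "Dom C g = Dom C f" "Cod C g = Cod C f"
  shows "Add C f g = Add C g f"
proof -
  interpret G: comm_group "hom_group C (Dom C f) (Cod C f)"
    by (rule hom_comm_group) (use assms in auto)
  from G.m_comm [of f g] assms show ?thesis
    by (auto simp: hom_group_def homset_def)
qed

lemma Zer_Add [simp]:
  assumes "f \<in> Arr C" "Dom C f = X" "Cod C f = Y"
  shows "Add C (Zer C X Y) f = f" "Add C f (Zer C X Y) = f"
proof -
  interpret G: comm_group "hom_group C X Y"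
    by (rule hom_comm_group) (use assms in auto)
  from G.l_one [of f] G.r_one [of f] assms
  show "Add C (Zer C X Y) f = f" "Add C f (Zer C X Y) = f"
    by (auto simp: hom_group_def homset_def)
qed

lemma ex_negative:
  assumes "f \<in> Arr C"
  obtains g where "g \<in> Arr C" "Dom C g = Dom C f" "Cod C g = Cod C f"
    "Add C f g = Zer C (Dom C f) (Cod C f)"
proof -
  interpret G: comm_group "hom_group C (Dom C f) (Cod C f)"
    by (rule hom_comm_group) (use assms in auto)
  from G.r_inv_ex [of f] assms that show ?thesis
    by (auto simp: hom_group_def homset_def)
qed

lemma Add_right_cancel:
  assumes "Add C f h = Add C g h" "f \<in> Arr C" "g \<in> Arr C" "h \<in> Arr C"
    "Dom C g = Dom C f" "Cod C g = Cod C f" "Dom C h = Dom C f" "Cod C h = Cod C f"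
  shows "f = g"
proof -
  interpret G: comm_group "hom_group C (Dom C f) (Cod C f)"
    by (rule hom_comm_group) (use assms in auto)
  from G.right_cancel [of h f g] assms show ?thesis
    by (auto simp: hom_group_def homset_def)
qed

lemma Cmp_Add_distrib [simp]:
  assumes "f \<in> Arr C" "g \<in> Arr C" "h \<in> Arr C"
    "Dom C g = Dom C f" "Cod C g = Cod C f" "Dom C h = Cod C f"
  shows "h \<cdot> Add C f g = Add C (h \<cdot> f) (h \<cdot> g)"
  using assms Cmp_Add [of f "Dom C f" "Cod C f" g h "Cod C h"] by (auto simp: homset_def)

lemma Add_Cmp_distrib [simp]:
  assumes "f \<in> Arr C" "g \<in> Arr C" "e \<in> Arr C"
    "Dom C g = Dom C f" "Cod C g = Cod C f" "Dom C f = Cod C e"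
  shows "Add C f g \<cdot> e = Add C (f \<cdot> e) (g \<cdot> e)"
  using assms Add_Cmp [of e "Dom C e" "Cod C e" f "Cod C f" g] by (auto simp: homset_def)

lemma Cmp_Zer [simp]:
  assumes "h \<in> Arr C" "X \<in> Obj C" "Dom C h = Y"
  shows "h \<cdot> Zer C X Y = Zer C X (Cod C h)"
proof -
  have [simp]: "Y \<in> Obj C" using assms by auto
  have "Add C (h \<cdot> Zer C X Y) (h \<cdot> Zer C X Y) = h \<cdot> Add C (Zer C X Y) (Zer C X Y)"
    using assms by (subst Cmp_Add_distrib) simp_all
  also have "\<dots> = Add C (Zer C X (Cod C h)) (h \<cdot> Zer C X Y)"
    using assms by simp
  finally show ?thesis
    by (rule Add_right_cancel) (use assms in simp_all)
qed

lemma Zer_Cmp [simp]: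
  assumes "h \<in> Arr C" "Y \<in> Obj C" "Cod C h = X"
  shows "Zer C X Y \<cdot> h = Zer C (Dom C h) Y"
proof -
  have [simp]: "X \<in> Obj C" using assms by auto
  have "Add C (Zer C X Y \<cdot> h) (Zer C X Y \<cdot> h) = Add C (Zer C X Y) (Zer C X Y) \<cdot> h"
    using assms by (subst Add_Cmp_distrib) simp_all
  also have "\<dots> = Add C (Zer C (Dom C h) Y) (Zer C X Y \<cdot> h)"
    using assms by simp
  finally show ?thesis
    by (rule Add_right_cancel) (use assms in simp_all)
qed

lemma zero_object_arr:
  assumes "zero_object C Z" "f \<in> Arr C" "Dom C f = Z \<or> Cod C f = Z"
  shows "f = Zer C (Dom C f) (Cod C f)"
proof -
  have "Dom C f \<in> Obj C" "Cod C f \<in> Obj C" using assms(2) by simp_all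
  with assms have ex1: "\<exists>!g. g \<in> homset C (Dom C f) (Cod C f)"
    unfolding zero_object_def by blast
  have "f \<in> homset C (Dom C f) (Cod C f)" "Zer C (Dom C f) (Cod C f) \<in> homset C (Dom C f) (Cod C f)"
    using assms(2) by (simp_all add: homset_def)
  with ex1 show ?thesis by blast
qed

text \<open>
  Subtraction in the hom-groups reduces cancellation of two arrows to that of one zero composite.
\<close>
lemma monicI_zero:
  assumes f: "f \<in> Arr C"
    and zero: "\<And>w. \<lbrakk>w \<in> Arr C; Cod C w = Dom C f; f \<cdot> w = Zer C (Dom C w) (Cod C f)\<rbrakk>
      \<Longrightarrow> w = Zer C (Dom C w) (Cod C w)"
  shows "monic C f"
  unfolding monic_def
proof (intro conjI allI ballI impI)
  fix X u v
  assume "u \<in> homset C X (Dom C f)" "v \<in> homset C X (Dom C f)" and eq: "f \<cdot> u = f \<cdot> v"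
  then have uv [simp]: "u \<in> Arr C" "v \<in> Arr C" "Dom C u = X" "Dom C v = X"
      "Cod C u = Dom C f" "Cod C v = Dom C f"
    by (auto simp: homset_def)
  obtain v' where v' [simp]: "v' \<in> Arr C" "Dom C v' = X" "Cod C v' = Dom C f"
      and vv': "Add C v v' = Zer C X (Dom C f)"
    using ex_negative [OF uv(2)] by auto
  have X [simp]: "X \<in> Obj C" using uv by (metis Dom_closed)
  have "f \<cdot> Add C u v' = f \<cdot> Add C v v'" using f eq by simp
  also have "\<dots> = Zer C X (Cod C f)" using f by (simp only: vv') simp
  finally have "Add C u v' = Add C v v'" using zero [of "Add C u v'"] f vv' by simp
  then show "u = v" by (rule Add_right_cancel) simp_all
qed (fact f)

lemma epicI_zero:
  assumes f: "f \<in> Arr C"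
    and zero: "\<And>w. \<lbrakk>w \<in> Arr C; Dom C w = Cod C f; w \<cdot> f = Zer C (Dom C f) (Cod C w)\<rbrakk>
      \<Longrightarrow> w = Zer C (Dom C w) (Cod C w)"
  shows "epic C f"
  unfolding epic_def
proof (intro conjI allI ballI impI)
  fix Y u v
  assume "u \<in> homset C (Cod C f) Y" "v \<in> homset C (Cod C f) Y" and eq: "u \<cdot> f = v \<cdot> f"
  then have uv [simp]: "u \<in> Arr C" "v \<in> Arr C" "Cod C u = Y" "Cod C v = Y"
      "Dom C u = Cod C f" "Dom C v = Cod C f"
    by (auto simp: homset_def)
  obtain v' where v' [simp]: "v' \<in> Arr C" "Dom C v' = Cod C f" "Cod C v' = Y"
      and vv': "Add C v v' = Zer C (Cod C f) Y"
    using ex_negative [OF uv(2)] by auto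
  have Y [simp]: "Y \<in> Obj C" using uv by (metis Cod_closed)
  have "Add C u v' \<cdot> f = Add C v v' \<cdot> f" using f eq by simp
  also have "\<dots> = Zer C (Dom C f) Y" using f by (simp only: vv') simp
  finally have "Add C u v' = Add C v v'" using zero [of "Add C u v'"] f vv' by simp
  then show "u = v" by (rule Add_right_cancel) simp_all
qed (fact f)

section \<open>Kernels and short exact sequences\<close>

lemma is_kernelD:
  assumes "is_kernel C f k"
  shows "f \<in> Arr C" "k \<in> Arr C" "Cod C k = Dom C f" "f \<cdot> k = Zer C (Dom C k) (Cod C f)"
  using assms by (auto simp: is_kernel_def)

lemma is_kernel_factor:
  assumes "is_kernel C f k" "h \<in> Arr C" "Cod C h = Dom C f" "f \<cdot> h = Zer C (Dom C h) (Cod C f)"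
  obtains u where "u \<in> Arr C" "Dom C u = Dom C h" "Cod C u = Dom C k" "k \<cdot> u = h"
  using assms unfolding is_kernel_def homset_def by blast

lemma is_kernel_monic:
  assumes "is_kernel C f k"
  shows "monic C k"
  unfolding monic_def
proof (intro conjI allI ballI impI)
  note [simp] = is_kernelD(1-3) [OF assms]
  show "k \<in> Arr C" by simp
  fix X u v
  assume uv: "u \<in> homset C X (Dom C k)" "v \<in> homset C X (Dom C k)" and eq: "k \<cdot> u = k \<cdot> v"
  then have [simp]: "u \<in> Arr C" "Dom C u = X" "Cod C u = Dom C k" by (auto simp: homset_def)
  have "f \<cdot> (k \<cdot> u) = Zer C (Dom C (k \<cdot> u)) (Cod C f)"
    by (simp add: Cmp_reassoc [OF is_kernelD(4) [OF assms]])
  moreover have "k \<cdot> u \<in> Arr C" "Cod C (k \<cdot> u) = Dom C f" "Dom C (k \<cdot> u) = X" by simp_all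
  ultimately have "\<exists>!w. w \<in> homset C X (Dom C k) \<and> k \<cdot> w = k \<cdot> u"
    using assms unfolding is_kernel_def by metis
  with uv eq show "u = v" by metis
qed

lemma is_kernelI:
  assumes "monic C k" "f \<in> Arr C" "Cod C k = Dom C f" "f \<cdot> k = Zer C (Dom C k) (Cod C f)"
    and factor: "\<And>h. \<lbrakk>h \<in> Arr C; Cod C h = Dom C f; f \<cdot> h = Zer C (Dom C h) (Cod C f)\<rbrakk>
      \<Longrightarrow> \<exists>u. u \<in> Arr C \<and> Dom C u = Dom C h \<and> Cod C u = Dom C k \<and> k \<cdot> u = h"
  shows "is_kernel C f k"
  unfolding is_kernel_def
proof (intro conjI ballI impI)
  show "k \<in> Arr C" using assms(1) by (simp add: monic_def)
  fix h assume h: "h \<in> Arr C" "Cod C h = Dom C f \<and> f \<cdot> h = Zer C (Dom C h) (Cod C f)"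
  then obtain u where "u \<in> Arr C" "Dom C u = Dom C h" "Cod C u = Dom C k" "k \<cdot> u = h"
    using factor by blast
  then show "\<exists>!u. u \<in> homset C (Dom C h) (Dom C k) \<and> k \<cdot> u = h"
    by (auto simp: homset_def intro: monicD [OF assms(1)])
qed (use assms in auto)

lemma is_kernel_unique:
  assumes "is_kernel C f k" "is_kernel C f l"
  shows "isomorphic C (Dom C k) (Dom C l)"
proof -
  note k [simp] = is_kernelD(1-3) [OF assms(1)]
  note l [simp] = is_kernelD(1-3) [OF assms(2)]
  obtain u where u [simp]: "u \<in> Arr C" "Dom C u = Dom C k" "Cod C u = Dom C l" and lu: "l \<cdot> u = k"
    using is_kernel_factor [OF assms(2), of k] is_kernelD [OF assms(1)] by metis
  obtain v where v [simp]: "v \<in> Arr C" "Dom C v = Dom C l" "Cod C v = Dom C k" and kv: "k \<cdot> v = l"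
    using is_kernel_factor [OF assms(1), of l] is_kernelD [OF assms(2)] by metis
  show ?thesis
  proof (rule isomorphicI [of u v])
    show "v \<cdot> u = Ide C (Dom C k)"
      by (rule monicD [OF is_kernel_monic [OF assms(1)]])
        (simp_all add: Cmp_reassoc [OF kv] lu)
    show "u \<cdot> v = Ide C (Dom C l)"
      by (rule monicD [OF is_kernel_monic [OF assms(2)]])
        (simp_all add: Cmp_reassoc [OF lu] kv)
  qed simp_all
qed

lemma is_kernel_monic_Cmp:
  assumes "is_kernel C (m \<cdot> e) k" "monic C m" "e \<in> Arr C" "Dom C m = Cod C e"
  shows "is_kernel C e k"
proof -
  have [simp]: "m \<in> Arr C" using assms(2) by (simp add: monic_def)
  note [simp] = assms(3,4)
  have k [simp]: "k \<in> Arr C" "Cod C k = Dom C e"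
    using is_kernelD [OF assms(1)] by simp_all
  show ?thesis
  proof (rule is_kernelI [OF is_kernel_monic [OF assms(1)]])
    show "e \<cdot> k = Zer C (Dom C k) (Cod C e)"
      by (rule monicD [OF assms(2)]) (use is_kernelD(4) [OF assms(1)] in simp_all)
    fix h assume h: "h \<in> Arr C" "Cod C h = Dom C e" "e \<cdot> h = Zer C (Dom C h) (Cod C e)"
    then have "(m \<cdot> e) \<cdot> h = Zer C (Dom C h) (Cod C (m \<cdot> e))" by simp
    with h show "\<exists>u. u \<in> Arr C \<and> Dom C u = Dom C h \<and> Cod C u = Dom C k \<and> k \<cdot> u = h"
      by (metis is_kernel_factor [OF assms(1)] Cmp_simps(2) \<open>m \<in> Arr C\<close> assms(3,4))
  qed simp_all
qed

text \<open>
  The identity is annihilated by a zero arrow, so it factors through the kernel.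
\<close>
lemma is_kernel_of_zero:
  assumes "is_kernel C g k" "g = Zer C (Dom C g) (Cod C g)"
  shows "isomorphic C (Dom C k) (Dom C g)"
proof -
  note k [simp] = is_kernelD(1-3) [OF assms(1)]
  have "g \<cdot> Ide C (Dom C g) = Zer C (Dom C (Ide C (Dom C g))) (Cod C g)"
    using assms(2) by simp
  then obtain u where u [simp]: "u \<in> Arr C" "Dom C u = Dom C g" "Cod C u = Dom C k"
      and ku: "k \<cdot> u = Ide C (Dom C g)"
    using is_kernel_factor [OF assms(1), of "Ide C (Dom C g)"] by auto
  have "u \<cdot> k = Ide C (Dom C k)"
    by (rule monicD [OF is_kernel_monic [OF assms(1)]]) (simp_all add: Cmp_reassoc [OF ku])
  then show ?thesis
    by (intro isomorphicI [of k u]) (simp_all add: ku)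
qed

end

definition short_exact :: "('o, 'm, 'x) add_cat_scheme \<Rightarrow> 'o \<Rightarrow> 'o \<Rightarrow> 'o \<Rightarrow> bool" where
  "short_exact C X Y W \<longleftrightarrow>
     (\<exists>k e. is_kernel C e k \<and> epic C e \<and> Dom C k = X \<and> Dom C e = Y \<and> Cod C e = W)"

context abelian_category
begin

text \<open>
  That the image leaves an epimorphism behind is where abelianness enters. If \<open>w\<close> kills \<open>e\<close>,
  then \<open>f\<close> factors through the subobject \<open>m \<cdot> ker w\<close> of \<open>m\<close>. That subobject is itself the kernel of
  some \<open>h\<close>, which kills \<open>f\<close>, hence factors through the cokernel of \<open>f\<close>, hence kills \<open>m\<close>. So
  \<open>m\<close> factors through \<open>m \<cdot> ker w\<close>, which makes \<open>ker w\<close> split epic and \<open>w\<close> zero.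
\<close>
lemma image_factorization:
  assumes "is_image C f m"
  obtains e where "epic C e" "Dom C e = Dom C f" "Cod C e = Dom C m" "m \<cdot> e = f"
proof -
  obtain c where c: "is_cokernel C f c" and m: "is_kernel C c m"
    using assms by (auto simp: is_image_def)
  have [simp]: "f \<in> Arr C" "c \<in> Arr C" "Dom C c = Cod C f" and cf: "c \<cdot> f = Zer C (Dom C f) (Cod C c)"
    using c by (auto simp: is_cokernel_def)
  have [simp]: "m \<in> Arr C" "Cod C m = Cod C f" using is_kernelD [OF m] by simp_all
  obtain e where e [simp]: "e \<in> Arr C" "Dom C e = Dom C f" "Cod C e = Dom C m" and me: "m \<cdot> e = f"
    using is_kernel_factor [OF m, of f] cf by auto
  have "epic C e"
  proof (rule epicI_zero)
    fix w assume w [simp]: "w \<in> Arr C" "Dom C w = Cod C e" and we: "w \<cdot> e = Zer C (Dom C e) (Cod C w)"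
    obtain k where k: "is_kernel C w k" using ex_kernel [OF w(1)] by blast
    note [simp] = is_kernelD(2,3) [OF k]
    obtain e' where e' [simp]: "e' \<in> Arr C" "Dom C e' = Dom C f" "Cod C e' = Dom C k"
        and ke': "k \<cdot> e' = e"
      using is_kernel_factor [OF k, of e] we by auto
    have "monic C (m \<cdot> k)"
      by (rule monic_Cmp [OF is_kernel_monic [OF k] is_kernel_monic [OF m]]) simp
    then obtain h where h: "is_kernel C h (m \<cdot> k)" using monic_is_kernel by blast
    have [simp]: "h \<in> Arr C" "Dom C h = Cod C f" using is_kernelD [OF h] by simp_all
    have hmk: "h \<cdot> (m \<cdot> k) = Zer C (Dom C k) (Cod C h)" using is_kernelD(4) [OF h] by simp
    have "h \<cdot> f = (h \<cdot> (m \<cdot> k)) \<cdot> e'" by (simp add: ke' me)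
    also have "\<dots> = Zer C (Dom C f) (Cod C h)" unfolding hmk by simp
    finally have "\<exists>t. t \<in> homset C (Cod C c) (Cod C h) \<and> t \<cdot> c = h"
      using c unfolding is_cokernel_def by (metis \<open>h \<in> Arr C\<close> \<open>Dom C h = Cod C f\<close>)
    then obtain t where [simp]: "t \<in> Arr C" "Dom C t = Cod C c" "Cod C t = Cod C h" and tc: "t \<cdot> c = h"
      by (auto simp: homset_def)
    have "h \<cdot> m = t \<cdot> (c \<cdot> m)" by (simp flip: tc)
    also have "\<dots> = Zer C (Dom C m) (Cod C h)" using is_kernelD(4) [OF m] by simp
    finally obtain s where s [simp]: "s \<in> Arr C" "Dom C s = Dom C m" "Cod C s = Dom C k"
        and mks: "(m \<cdot> k) \<cdot> s = m"
      using is_kernel_factor [OF h, of m] by auto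
    have ks: "k \<cdot> s = Ide C (Dom C m)"
      by (rule monicD [OF is_kernel_monic [OF m]]) (use mks in simp_all)
    have "w = w \<cdot> (k \<cdot> s)" by (simp add: ks)
    also have "\<dots> = Zer C (Dom C w) (Cod C w)"
      by (simp add: Cmp_reassoc [OF is_kernelD(4) [OF k]])
    finally show "w = Zer C (Dom C w) (Cod C w)" .
  qed simp
  then show thesis using that me by simp
qed

text \<open>
  An epimorphism is the cokernel of some \<open>f\<close>; if its kernel vanishes then so does \<open>f\<close>, and the
  identity factors through the cokernel.
\<close>
lemma epic_with_zero_kernel:
  assumes "epic C e" "is_kernel C e k" "k = Zer C (Dom C k) (Cod C k)"
  shows "isomorphic C (Dom C e) (Cod C e)"
proof -
  note [simp] = is_kernelD(1-3) [OF assms(2)]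
  obtain f where f: "is_cokernel C f e" using epic_is_cokernel [OF assms(1)] by blast
  have [simp]: "f \<in> Arr C" "Cod C f = Dom C e" and ef: "e \<cdot> f = Zer C (Dom C f) (Cod C e)"
    using f by (auto simp: is_cokernel_def)
  obtain u where [simp]: "u \<in> Arr C" "Dom C u = Dom C f" "Cod C u = Dom C k" and ku: "k \<cdot> u = f"
    using is_kernel_factor [OF assms(2), of f] ef by auto
  have "Ide C (Dom C e) \<cdot> f = Zer C (Dom C f) (Dom C e)"
    using assms(3) ku by simp (metis Zer_Cmp \<open>Cod C k = Dom C e\<close> \<open>u \<in> Arr C\<close>
      \<open>Dom C u = Dom C f\<close> \<open>Cod C u = Dom C k\<close> \<open>e \<in> Arr C\<close> Dom_closed)
  then have "\<exists>t. t \<in> homset C (Cod C e) (Dom C e) \<and> t \<cdot> e = Ide C (Dom C e)"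
    using f unfolding is_cokernel_def by (metis Ide_simps \<open>Cod C f = Dom C e\<close> \<open>e \<in> Arr C\<close> Dom_closed)
  then obtain t where [simp]: "t \<in> Arr C" "Dom C t = Cod C e" "Cod C t = Dom C e"
      and te: "t \<cdot> e = Ide C (Dom C e)"
    by (auto simp: homset_def)
  have "e \<cdot> t = Ide C (Cod C e)"
    by (rule epicD [OF assms(1)]) (simp_all add: te)
  then show ?thesis
    by (intro isomorphicI [of e t]) (simp_all add: te)
qed

end

section \<open>Direct sums\<close>

text \<open>
  Naming the four structure arrows of a biproduct allows the same object to be given several
  different decompositions, which the shear below relies on.
\<close>
definition biproduct_arrows ::
  "('o, 'm, 'x) add_cat_scheme \<Rightarrow> 'o \<Rightarrow> 'o \<Rightarrow> 'o \<Rightarrow> 'm \<Rightarrow> 'm \<Rightarrow> 'm \<Rightarrow> 'm \<Rightarrow> bool" where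
  "biproduct_arrows C X Y S i j p q \<longleftrightarrow>
     i \<in> homset C X S \<and> j \<in> homset C Y S \<and> p \<in> homset C S X \<and> q \<in> homset C S Y \<and>
     p \<cdot>\<^bsub>C\<^esub> i = Ide C X \<and> q \<cdot>\<^bsub>C\<^esub> j = Ide C Y \<and>
     p \<cdot>\<^bsub>C\<^esub> j = Zer C Y X \<and> q \<cdot>\<^bsub>C\<^esub> i = Zer C X Y \<and>
     Add C (i \<cdot>\<^bsub>C\<^esub> p) (j \<cdot>\<^bsub>C\<^esub> q) = Ide C S"

lemma is_biproduct_iff: "is_biproduct C X Y S \<longleftrightarrow> (\<exists>i j p q. biproduct_arrows C X Y S i j p q)"
  unfolding is_biproduct_def biproduct_arrows_def by blast

context preadditive_category
begin

lemma biproduct_arrows_swap: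
  assumes "biproduct_arrows C X Y S i j p q"
  shows "biproduct_arrows C Y X S j i q p"
  using assms Add_commute [of "i \<cdot> p" "j \<cdot> q"]
  by (auto simp: biproduct_arrows_def homset_def)

lemma biproduct_arrows_typing:
  assumes "biproduct_arrows C X Y S i j p q"
  shows "X \<in> Obj C" "Y \<in> Obj C" "S \<in> Obj C" "i \<in> Arr C" "j \<in> Arr C" "p \<in> Arr C" "q \<in> Arr C"
    "Dom C i = X" "Cod C i = S" "Dom C j = Y" "Cod C j = S"
    "Dom C p = S" "Cod C p = X" "Dom C q = S" "Cod C q = Y"
  using assms Dom_closed Cod_closed unfolding biproduct_arrows_def homset_def by auto

lemma biproduct_arrows_equations:
  assumes "biproduct_arrows C X Y S i j p q"
  shows "p \<cdot> i = Ide C X" "q \<cdot> j = Ide C Y" "p \<cdot> j = Zer C Y X" "q \<cdot> i = Zer C X Y"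
    and "\<lbrakk>h \<in> Arr C; Cod C h = X\<rbrakk> \<Longrightarrow> p \<cdot> (i \<cdot> h) = h"
    and "\<lbrakk>h \<in> Arr C; Cod C h = Y\<rbrakk> \<Longrightarrow> q \<cdot> (j \<cdot> h) = h"
    and "\<lbrakk>h \<in> Arr C; Cod C h = Y\<rbrakk> \<Longrightarrow> p \<cdot> (j \<cdot> h) = Zer C (Dom C h) X"
    and "\<lbrakk>h \<in> Arr C; Cod C h = X\<rbrakk> \<Longrightarrow> q \<cdot> (i \<cdot> h) = Zer C (Dom C h) Y"
proof -
  note [simp] = biproduct_arrows_typing [OF assms]
  show eqs: "p \<cdot> i = Ide C X" "q \<cdot> j = Ide C Y" "p \<cdot> j = Zer C Y X" "q \<cdot> i = Zer C X Y"
    using assms by (simp_all add: biproduct_arrows_def)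
  show "\<lbrakk>h \<in> Arr C; Cod C h = X\<rbrakk> \<Longrightarrow> p \<cdot> (i \<cdot> h) = h"
    "\<lbrakk>h \<in> Arr C; Cod C h = Y\<rbrakk> \<Longrightarrow> q \<cdot> (j \<cdot> h) = h"
    "\<lbrakk>h \<in> Arr C; Cod C h = Y\<rbrakk> \<Longrightarrow> p \<cdot> (j \<cdot> h) = Zer C (Dom C h) X"
    "\<lbrakk>h \<in> Arr C; Cod C h = X\<rbrakk> \<Longrightarrow> q \<cdot> (i \<cdot> h) = Zer C (Dom C h) Y"
    by (simp_all add: eqs [THEN Cmp_reassoc])
qed

lemma biproduct_arrows_decompose:
  assumes "biproduct_arrows C X Y S i j p q" "h \<in> Arr C" "Cod C h = S"
  shows "Add C (i \<cdot> (p \<cdot> h)) (j \<cdot> (q \<cdot> h)) = h"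
proof -
  note [simp] = biproduct_arrows_typing [OF assms(1)] assms(2,3)
  have "Add C (i \<cdot> p) (j \<cdot> q) \<cdot> h = h"
    using assms(1) by (simp add: biproduct_arrows_def del: Add_Cmp_distrib)
  then show ?thesis by simp
qed

lemma biproduct_arrows_codecompose:
  assumes "biproduct_arrows C X Y S i j p q" "h \<in> Arr C" "Dom C h = S"
  shows "Add C (h \<cdot> (i \<cdot> p)) (h \<cdot> (j \<cdot> q)) = h"
proof -
  note [simp] = biproduct_arrows_typing [OF assms(1)] assms(2,3)
  have "h \<cdot> Add C (i \<cdot> p) (j \<cdot> q) = h"
    using assms(1) by (simp add: biproduct_arrows_def del: Cmp_Add_distrib)
  then show ?thesis by simp
qed

lemma is_biproduct_isomorphic:
  assumes "isomorphic C X X'" "is_biproduct C X Y S" "is_biproduct C X' Y S'"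
  shows "isomorphic C S S'"
proof -
  obtain f g where [simp]: "f \<in> Arr C" "g \<in> Arr C" "Dom C f = X" "Cod C f = X'" "Dom C g = X'"
      "Cod C g = X" and gf: "g \<cdot> f = Ide C X" "f \<cdot> g = Ide C X'"
    using assms(1) by (rule isomorphicE)
  obtain i j p q where S: "biproduct_arrows C X Y S i j p q"
    using assms(2) by (auto simp: is_biproduct_iff)
  obtain i' j' p' q' where S': "biproduct_arrows C X' Y S' i' j' p' q'"
    using assms(3) by (auto simp: is_biproduct_iff)
  note [simp] = biproduct_arrows_typing [OF S] biproduct_arrows_equations [OF S]
    biproduct_arrows_typing [OF S'] biproduct_arrows_equations [OF S']
    gf [THEN Cmp_reassoc]
  show ?thesis
  proof (rule isomorphicI)
    let ?u = "Add C (i' \<cdot> (f \<cdot> p)) (j' \<cdot> q)" and ?v = "Add C (i \<cdot> (g \<cdot> p')) (j \<cdot> q')"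
    show "?v \<cdot> ?u = Ide C S" using biproduct_arrows_decompose [OF S, of "Ide C S"] by simp
    show "?u \<cdot> ?v = Ide C S'" using biproduct_arrows_decompose [OF S', of "Ide C S'"] by simp
  qed simp_all
qed

lemma is_biproduct_zero_right:
  assumes "X \<in> Obj C" "zero_object C Z"
  shows "is_biproduct C X Z X"
proof -
  have [simp]: "X \<in> Obj C" "Z \<in> Obj C" using assms by (auto simp: zero_object_def)
  have "Zer C Z Z = Ide C Z" using zero_object_arr [OF assms(2), of "Ide C Z"] by simp
  then have "biproduct_arrows C X Z X (Ide C X) (Zer C Z X) (Ide C X) (Zer C X Z)"
    by (simp add: biproduct_arrows_def homset_def)
  then show ?thesis by (auto simp: is_biproduct_iff)
qed

lemma projective_zero_object:
  assumes "zero_object C Z"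
  shows "projective C Z"
  unfolding projective_def
proof (intro conjI allI impI)
  show [simp]: "Z \<in> Obj C" using assms by (simp add: zero_object_def)
  fix e f assume ef: "epic C e \<and> f \<in> homset C Z (Cod C e)"
  then have [simp]: "e \<in> Arr C" by (simp add: epic_def)
  have "f = Zer C Z (Cod C e)"
    using zero_object_arr [OF assms, of f] ef by (auto simp: homset_def)
  then show "\<exists>g \<in> homset C Z (Dom C e). e \<cdot> g = f"
    by (intro bexI [of _ "Zer C Z (Dom C e)"]) (simp_all add: homset_def)
qed

lemma projective_lift:
  assumes "projective C P" "epic C e" "f \<in> Arr C" "Dom C f = P" "Cod C f = Cod C e"
  obtains g where "g \<in> Arr C" "Dom C g = P" "Cod C g = Dom C e" "e \<cdot> g = f"
  using assms unfolding projective_def homset_def by blast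

lemma projective_biproduct:
  assumes "projective C P" "projective C Q" "is_biproduct C P Q S"
  shows "projective C S"
proof -
  obtain i j p q where S: "biproduct_arrows C P Q S i j p q"
    using assms(3) by (auto simp: is_biproduct_iff)
  note [simp] = biproduct_arrows_typing [OF S]
  show ?thesis
    unfolding projective_def
  proof (intro conjI allI impI)
    fix e f assume ef: "epic C e \<and> f \<in> homset C S (Cod C e)"
    then have e: "epic C e" and [simp]: "e \<in> Arr C" "f \<in> Arr C" "Dom C f = S" "Cod C f = Cod C e"
      by (auto simp: epic_def homset_def)
    obtain u where [simp]: "u \<in> Arr C" "Dom C u = P" "Cod C u = Dom C e" and eu: "e \<cdot> u = f \<cdot> i"
      by (rule projective_lift [OF assms(1) e, of "f \<cdot> i"]) simp_all
    obtain v where [simp]: "v \<in> Arr C" "Dom C v = Q" "Cod C v = Dom C e" and ev: "e \<cdot> v = f \<cdot> j"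
      by (rule projective_lift [OF assms(2) e, of "f \<cdot> j"]) simp_all
    have "e \<cdot> Add C (u \<cdot> p) (v \<cdot> q) = f"
      using biproduct_arrows_codecompose [OF S, of f]
      by (simp add: eu [THEN Cmp_reassoc] ev [THEN Cmp_reassoc])
    then show "\<exists>g \<in> homset C S (Dom C e). e \<cdot> g = f"
      by (intro bexI [of _ "Add C (u \<cdot> p) (v \<cdot> q)"]) (simp_all add: homset_def)
  qed simp
qed

text \<open>
  The direct sum of a short exact sequence with \<open>0 \<rightarrow> E \<rightarrow> E\<close>, the last arrow being the identity.
\<close>
lemma short_exact_add_summand:
  assumes "short_exact C X Y W" "is_biproduct C Y E Y'" "is_biproduct C W E W'"
  shows "short_exact C X Y' W'"
proof -
  obtain k e where k: "is_kernel C e k" and e: "epic C e"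
      and [simp]: "Dom C k = X" "Dom C e = Y" "Cod C e = W"
    using assms(1) by (auto simp: short_exact_def)
  note [simp] = is_kernelD [OF k]
  obtain i j p q where Y': "biproduct_arrows C Y E Y' i j p q"
    using assms(2) by (auto simp: is_biproduct_iff)
  obtain i' j' p' q' where W': "biproduct_arrows C W E W' i' j' p' q'"
    using assms(3) by (auto simp: is_biproduct_iff)
  note [simp] = biproduct_arrows_typing [OF Y'] biproduct_arrows_equations [OF Y']
    biproduct_arrows_typing [OF W'] biproduct_arrows_equations [OF W']
  let ?e = "Add C (i' \<cdot> (e \<cdot> p)) (j' \<cdot> q)"
  have X [simp]: "X \<in> Obj C" using Dom_closed [of k] by simp
  have "monic C (i \<cdot> k)"
  proof (rule monicI_zero)
    fix w assume w [simp]: "w \<in> Arr C" "Cod C w = Dom C (i \<cdot> k)"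
      and "(i \<cdot> k) \<cdot> w = Zer C (Dom C w) (Cod C (i \<cdot> k))"
    then have "p \<cdot> (i \<cdot> (k \<cdot> w)) = p \<cdot> Zer C (Dom C w) Y'" by simp
    then have "k \<cdot> w = k \<cdot> Zer C (Dom C w) X" by simp
    then have "w = Zer C (Dom C w) X"
      by (rule monicD [OF is_kernel_monic [OF k]]) simp_all
    then show "w = Zer C (Dom C w) (Cod C w)" by simp
  qed simp
  then have "is_kernel C ?e (i \<cdot> k)"
  proof (rule is_kernelI)
    fix h assume [simp]: "h \<in> Arr C" "Cod C h = Dom C ?e"
      and "?e \<cdot> h = Zer C (Dom C h) (Cod C ?e)"
    then have eh: "Add C (i' \<cdot> (e \<cdot> (p \<cdot> h))) (j' \<cdot> (q \<cdot> h)) = Zer C (Dom C h) W'" by simp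
    from arg_cong [OF eh, of "\<lambda>x. p' \<cdot> x"] have "e \<cdot> (p \<cdot> h) = Zer C (Dom C h) W" by simp
    then obtain u where [simp]: "u \<in> Arr C" "Dom C u = Dom C h" "Cod C u = X" and ku: "k \<cdot> u = p \<cdot> h"
      using is_kernel_factor [OF k, of "p \<cdot> h"] by auto
    from arg_cong [OF eh, of "\<lambda>x. q' \<cdot> x"] have "q \<cdot> h = Zer C (Dom C h) E" by simp
    then have "(i \<cdot> k) \<cdot> u = h"
      using biproduct_arrows_decompose [OF Y', of h] by (simp add: ku)
    then show "\<exists>u. u \<in> Arr C \<and> Dom C u = Dom C h \<and> Cod C u = Dom C (i \<cdot> k) \<and> (i \<cdot> k) \<cdot> u = h"
      by (intro exI [of _ u]) simp
  qed (simp_all add: Cmp_reassoc [OF is_kernelD(4) [OF k]])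
  moreover have "epic C ?e"
  proof (rule epicI_zero)
    fix w assume [simp]: "w \<in> Arr C" "Dom C w = Cod C ?e"
      and "w \<cdot> ?e = Zer C (Dom C ?e) (Cod C w)"
    then have we: "Add C (w \<cdot> (i' \<cdot> (e \<cdot> p))) (w \<cdot> (j' \<cdot> q)) = Zer C Y' (Cod C w)" by simp
    from arg_cong [OF we, of "\<lambda>x. x \<cdot> i"] have "(w \<cdot> i') \<cdot> e = Zer C W (Cod C w) \<cdot> e" by simp
    then have wi: "w \<cdot> i' = Zer C W (Cod C w)" by (rule epicD [OF e]) simp_all
    from arg_cong [OF we, of "\<lambda>x. x \<cdot> j"] have wj: "w \<cdot> j' = Zer C E (Cod C w)" by simp
    show "w = Zer C (Dom C w) (Cod C w)"
      using biproduct_arrows_codecompose [OF W', of w]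
      by (simp add: wi [THEN Cmp_reassoc] wj [THEN Cmp_reassoc])
  qed simp
  ultimately show ?thesis unfolding short_exact_def by (intro exI [of _ "i \<cdot> k"] exI [of _ ?e]) simp
qed

lemma short_exact_isomorphic:
  assumes "short_exact C X Y W" "isomorphic C W W'"
  shows "short_exact C X Y W'"
proof -
  obtain k e where k: "is_kernel C e k" and e: "epic C e"
      and [simp]: "Dom C k = X" "Dom C e = Y" "Cod C e = W"
    using assms(1) by (auto simp: short_exact_def)
  note [simp] = is_kernelD [OF k]
  obtain f g where [simp]: "f \<in> Arr C" "g \<in> Arr C" "Dom C f = W" "Cod C f = W'" "Dom C g = W'"
      "Cod C g = W" and gf: "g \<cdot> f = Ide C W" "f \<cdot> g = Ide C W'"
    using assms(2) by (rule isomorphicE)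
  have [simp]: "W \<in> Obj C" "W' \<in> Obj C" "X \<in> Obj C"
    using Dom_closed [of f] Cod_closed [of f] Dom_closed [of k] by simp_all
  have "is_kernel C (f \<cdot> e) k"
  proof (rule is_kernelI [OF is_kernel_monic [OF k]])
    fix h assume [simp]: "h \<in> Arr C" "Cod C h = Dom C (f \<cdot> e)"
      and "(f \<cdot> e) \<cdot> h = Zer C (Dom C h) (Cod C (f \<cdot> e))"
    then have "g \<cdot> (f \<cdot> (e \<cdot> h)) = g \<cdot> Zer C (Dom C h) W'" by simp
    then have "e \<cdot> h = Zer C (Dom C h) W" by (simp add: gf [THEN Cmp_reassoc])
    then obtain u where "u \<in> Arr C" "Dom C u = Dom C h" "Cod C u = Dom C k" "k \<cdot> u = h"
      using is_kernel_factor [OF k, of h] by auto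
    then show "\<exists>u. u \<in> Arr C \<and> Dom C u = Dom C h \<and> Cod C u = Dom C k \<and> k \<cdot> u = h" by blast
  qed simp_all
  moreover have "epic C (f \<cdot> e)"
  proof (rule epicI_zero)
    fix w assume [simp]: "w \<in> Arr C" "Dom C w = Cod C (f \<cdot> e)"
      and we: "w \<cdot> (f \<cdot> e) = Zer C (Dom C (f \<cdot> e)) (Cod C w)"
    have "w \<cdot> f = Zer C W (Cod C w)"
      by (rule epicD [OF e]) (use we in simp_all)
    from arg_cong [OF this, of "\<lambda>x. x \<cdot> g"] show "w = Zer C (Dom C w) (Cod C w)"
      by (simp add: gf)
  qed simp
  ultimately show ?thesis unfolding short_exact_def by (intro exI [of _ k] exI [of _ "f \<cdot> e"]) simp
qed

section \<open>Schanuel's lemma\<close>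

text \<open>
  The automorphism of \<open>X \<oplus> Y\<close> with matrix entries \<open>1\<close>, \<open>c\<close>, \<open>0\<close>, \<open>1\<close>, where \<open>c = -b\<close>, carries one
  biproduct decomposition to another. The first injection and the second projection survive.
\<close>
lemma biproduct_arrows_shear:
  assumes "biproduct_arrows C X Y S i j p q"
    and "b \<in> Arr C" "Dom C b = Y" "Cod C b = X"
    and "c \<in> Arr C" "Dom C c = Y" "Cod C c = X" "Add C b c = Zer C Y X"
  shows "biproduct_arrows C X Y S i (Add C j (i \<cdot> c)) (Add C p (b \<cdot> q)) q"
proof -
  note [simp] = biproduct_arrows_typing [OF assms(1)] biproduct_arrows_equations [OF assms(1)]
    assms(2-7)
  have 1: "Add C (p \<cdot> Add C j (i \<cdot> c)) (b \<cdot> (q \<cdot> Add C j (i \<cdot> c))) = Zer C Y X"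
    using assms(8) Add_commute [of b c] by simp
  have "Add C (i \<cdot> (b \<cdot> q)) (i \<cdot> (c \<cdot> q)) = i \<cdot> (Add C b c \<cdot> q)" by simp
  also have "\<dots> = Zer C S S" unfolding assms(8) by simp
  finally have bc: "Add C (i \<cdot> (b \<cdot> q)) (i \<cdot> (c \<cdot> q)) = Zer C S S" .
  have "Add C (i \<cdot> Add C p (b \<cdot> q)) (Add C j (i \<cdot> c) \<cdot> q)
      = Add C (i \<cdot> p) (Add C (i \<cdot> (b \<cdot> q)) (Add C (i \<cdot> (c \<cdot> q)) (j \<cdot> q)))"
    using Add_commute [of "j \<cdot> q" "i \<cdot> (c \<cdot> q)"] by simp
  also have "\<dots> = Add C (i \<cdot> p) (Add C (Add C (i \<cdot> (b \<cdot> q)) (i \<cdot> (c \<cdot> q))) (j \<cdot> q))"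
    by simp
  also have "\<dots> = Ide C S"
    unfolding bc using biproduct_arrows_decompose [OF assms(1), of "Ide C S"] by simp
  finally have 2: "Add C (i \<cdot> Add C p (b \<cdot> q)) (Add C j (i \<cdot> c) \<cdot> q) = Ide C S" .
  show ?thesis
    unfolding biproduct_arrows_def using 1 2 by (intro conjI) (simp_all add: homset_def assms(8))
qed

text \<open>
  The kernel of \<open>(a, 0) : P \<oplus> Q \<rightarrow> B\<close> is \<open>ker a \<oplus> Q\<close>. The arrow \<open>(a, 0)\<close> is given by its composites
  with the injections, so that the lemma applies to a sheared decomposition of the same arrow.
\<close>
lemma kernel_zero_summand:
  assumes "is_kernel C a k" "biproduct_arrows C (Dom C a) Q T i j p q" "is_biproduct C (Dom C k) Q S"
    and "r \<in> Arr C" "Dom C r = T" "r \<cdot> i = a" "r \<cdot> j = Zer C Q (Cod C r)"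
  obtains l where "is_kernel C r l" "Dom C l = S"
proof -
  obtain i' j' p' q' where S: "biproduct_arrows C (Dom C k) Q S i' j' p' q'"
    using assms(3) by (auto simp: is_biproduct_iff)
  note k [simp] = is_kernelD [OF assms(1)]
  note [simp] = biproduct_arrows_typing [OF S] biproduct_arrows_equations [OF S]
    biproduct_arrows_typing [OF assms(2)] biproduct_arrows_equations [OF assms(2)] assms(4,5)
  have [simp]: "Cod C a = Cod C r" by (simp flip: assms(6))
  let ?l = "Add C (i \<cdot> (k \<cdot> p')) (j \<cdot> q')"
  have "monic C ?l"
  proof (rule monicI_zero)
    fix w assume [simp]: "w \<in> Arr C" "Cod C w = Dom C ?l"
      and "?l \<cdot> w = Zer C (Dom C w) (Cod C ?l)"
    then have lw: "Add C (i \<cdot> (k \<cdot> (p' \<cdot> w))) (j \<cdot> (q' \<cdot> w)) = Zer C (Dom C w) T" by simp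
    from arg_cong [OF lw, of "\<lambda>x. q \<cdot> x"] have qw: "q' \<cdot> w = Zer C (Dom C w) Q" by simp
    from arg_cong [OF lw, of "\<lambda>x. p \<cdot> x"] have "k \<cdot> (p' \<cdot> w) = k \<cdot> Zer C (Dom C w) (Dom C k)" by simp
    then have pw: "p' \<cdot> w = Zer C (Dom C w) (Dom C k)"
      by (rule monicD [OF is_kernel_monic [OF assms(1)]]) simp_all
    show "w = Zer C (Dom C w) (Cod C w)"
      using biproduct_arrows_decompose [OF S, of w] by (simp add: pw qw)
  qed simp
  then have "is_kernel C r ?l"
  proof (rule is_kernelI)
    show "r \<cdot> ?l = Zer C (Dom C ?l) (Cod C r)"
      by (simp add: assms(6,7) [THEN Cmp_reassoc] Cmp_reassoc [OF k(4)])
    fix h assume [simp]: "h \<in> Arr C" "Cod C h = Dom C r" and rh: "r \<cdot> h = Zer C (Dom C h) (Cod C r)"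
    have "r \<cdot> Add C (i \<cdot> (p \<cdot> h)) (j \<cdot> (q \<cdot> h)) = r \<cdot> h"
      using biproduct_arrows_decompose [OF assms(2), of h] by simp
    then have "a \<cdot> (p \<cdot> h) = Zer C (Dom C h) (Cod C r)"
      by (simp add: assms(6,7) [THEN Cmp_reassoc] rh)
    then obtain u where [simp]: "u \<in> Arr C" "Dom C u = Dom C h" "Cod C u = Dom C k" and ku: "k \<cdot> u = p \<cdot> h"
      using is_kernel_factor [OF assms(1), of "p \<cdot> h"] by auto
    have "?l \<cdot> Add C (i' \<cdot> u) (j' \<cdot> (q \<cdot> h)) = h"
      using biproduct_arrows_decompose [OF assms(2), of h] by (simp add: ku)
    then show "\<exists>u. u \<in> Arr C \<and> Dom C u = Dom C h \<and> Cod C u = Dom C ?l \<and> ?l \<cdot> u = h"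
      by (intro exI [of _ "Add C (i' \<cdot> u) (j' \<cdot> (q \<cdot> h))"]) simp
  qed simp_all
  with that show thesis by simp
qed

text \<open>
  When \<open>a\<close> is epic and \<open>Q\<close> projective, the second component of \<open>r\<close> lifts along \<open>a\<close> to some \<open>b\<close>.
  Shearing by \<open>b\<close> changes the second injection into \<open>j - i \<cdot> b\<close>, which \<open>r\<close> kills; this is the
  situation of \<open>kernel_zero_summand\<close>. The kernel object therefore does not depend on \<open>r \<cdot> j\<close>.
\<close>
lemma kernel_projective_summand:
  assumes "is_kernel C a k" "epic C a" "projective C Q" "biproduct_arrows C (Dom C a) Q T i j p q"
    and "is_biproduct C (Dom C k) Q S"
    and "r \<in> Arr C" "Dom C r = T" "r \<cdot> i = a"
  obtains l where "is_kernel C r l" "Dom C l = S"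
proof -
  note k [simp] = is_kernelD [OF assms(1)]
  note [simp] = biproduct_arrows_typing [OF assms(4)] biproduct_arrows_equations [OF assms(4)] assms(6,7)
  have a [simp]: "Cod C a = Cod C r" by (simp flip: assms(8))
  obtain b where b [simp]: "b \<in> Arr C" "Dom C b = Q" "Cod C b = Dom C a" and ab: "a \<cdot> b = r \<cdot> j"
    by (rule projective_lift [OF assms(3,2), of "r \<cdot> j"]) simp_all
  obtain c where c [simp]: "c \<in> Arr C" "Dom C c = Q" "Cod C c = Dom C a"
      and bc: "Add C b c = Zer C Q (Dom C a)"
    using ex_negative [OF b(1)] by auto
  have "r \<cdot> Add C j (i \<cdot> c) = a \<cdot> Add C b c"
    by (simp add: Cmp_reassoc [OF assms(8)] ab)
  also have "\<dots> = Zer C Q (Cod C r)" by (simp only: bc) simp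
  finally have "r \<cdot> Add C j (i \<cdot> c) = Zer C Q (Cod C r)" .
  then show thesis
    by (rule kernel_zero_summand [OF assms(1) biproduct_arrows_shear [OF assms(4) b c bc] assms(5-8) _ that])
qed

end

context abelian_category
begin

text \<open>
  Both sides are kernels of the same arrow \<open>(a, b) : P \<oplus> Q \<rightarrow> B\<close>, by
  \<open>kernel_projective_summand\<close> and the symmetry of biproducts.
\<close>
lemma Schanuel:
  assumes "short_exact C K P B" "short_exact C L Q B" "projective C P" "projective C Q"
    and "is_biproduct C K Q S" "is_biproduct C L P S'"
  shows "isomorphic C S S'"
proof -
  obtain k a where k: "is_kernel C a k" "epic C a"
      and [simp]: "Dom C k = K" "Dom C a = P" "Cod C a = B"
    using assms(1) by (auto simp: short_exact_def)
  obtain l b where l: "is_kernel C b l" "epic C b"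
      and [simp]: "Dom C l = L" "Dom C b = Q" "Cod C b = B"
    using assms(2) by (auto simp: short_exact_def)
  note [simp] = is_kernelD [OF k(1)] is_kernelD [OF l(1)]
  have "P \<in> Obj C" "Q \<in> Obj C" using assms(3,4) by (auto simp: projective_def)
  then obtain T i j p q where T: "biproduct_arrows C P Q T i j p q"
    using ex_biproduct [of P Q] by (auto simp: is_biproduct_iff)
  note [simp] = biproduct_arrows_typing [OF T] biproduct_arrows_equations [OF T]
  have [simp]: "B \<in> Obj C" using Cod_closed [of a] by simp
  let ?r = "Add C (a \<cdot> p) (b \<cdot> q)"
  obtain s where s: "is_kernel C ?r s" "Dom C s = S"
    by (rule kernel_projective_summand [OF k assms(4), of T i j p q S ?r]) (use T assms(5) in simp_all)
  obtain t where t: "is_kernel C ?r t" "Dom C t = S'"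
    by (rule kernel_projective_summand [OF l assms(3), of T j i q p S' ?r])
      (use biproduct_arrows_swap [OF T] assms(6) in simp_all)
  from is_kernel_unique [OF s(1) t(1)] s(2) t(2) show ?thesis by simp
qed

section \<open>The generalized Schanuel lemma\<close>

lemma direct_sum_Nil: "zero_object C (direct_sum C [])"
  using someI_ex [OF ex_zero_object] by simp

lemma biprod_is_biproduct: "\<lbrakk>X \<in> Obj C; Y \<in> Obj C\<rbrakk> \<Longrightarrow> is_biproduct C X Y (biprod C X Y)"
  unfolding biprod_def by (rule someI_ex) (rule ex_biproduct)

lemma is_biproduct_Obj: "is_biproduct C X Y S \<Longrightarrow> S \<in> Obj C"
  by (auto simp: is_biproduct_iff dest: biproduct_arrows_typing)

lemma direct_sum_Obj: "set Xs \<subseteq> Obj C \<Longrightarrow> direct_sum C Xs \<in> Obj C"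
proof (induction Xs rule: induct_list012)
  case 1
  then show ?case using direct_sum_Nil unfolding zero_object_def by blast
next
  case (3 X Y Ys)
  then show ?case using biprod_is_biproduct [THEN is_biproduct_Obj] by simp
qed simp

text \<open>
  A one-element direct sum is the element itself rather than its sum with a zero object; since
  that sum is isomorphic to it, induction needs no separate case for the empty tail.
\<close>
lemma direct_sum_Cons:
  assumes "X \<in> Obj C" "set Xs \<subseteq> Obj C"
  shows "is_biproduct C X (direct_sum C Xs) (direct_sum C (X # Xs))"
proof (cases Xs)
  case Nil
  then show ?thesis using is_biproduct_zero_right [OF assms(1) direct_sum_Nil] by simp
next
  case (Cons Y Ys)
  then show ?thesis using biprod_is_biproduct [OF assms(1) direct_sum_Obj [OF assms(2)]] by simp
qed

lemma projective_direct_sum: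
  assumes "\<And>X. X \<in> set Xs \<Longrightarrow> projective C X"
  shows "projective C (direct_sum C Xs)"
  using assms
proof (induction Xs)
  case Nil
  show ?case by (rule projective_zero_object [OF direct_sum_Nil])
next
  case (Cons X Xs)
  then have "X \<in> Obj C" "set Xs \<subseteq> Obj C" by (auto simp: projective_def)
  with Cons show ?case by (intro projective_biproduct [OF _ _ direct_sum_Cons]) auto
qed

lemma isomorphic_direct_sum_Cons:
  assumes "isomorphic C X X'" "set Xs \<subseteq> Obj C"
  shows "isomorphic C (direct_sum C (X # Xs)) (direct_sum C (X' # Xs))"
proof -
  have "X \<in> Obj C" "X' \<in> Obj C" using assms(1) by (auto simp: isomorphic_def)
  then show ?thesis
    using is_biproduct_isomorphic [OF assms(1) direct_sum_Cons direct_sum_Cons] assms(2) by blast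
qed

end

text \<open>
  The summands other than \<open>K\<close> in the direct sum for \<open>n\<close>. Comparing the parity of the index with that
  of \<open>n\<close> treats even and odd \<open>n\<close> together: the leading summand, of index \<open>n - 1\<close>, is always a \<open>Q\<close>,
  and passing to \<open>n + 1\<close> exchanges the roles of the two families.
\<close>
definition alternating :: "(nat \<Rightarrow> 'o) \<Rightarrow> (nat \<Rightarrow> 'o) \<Rightarrow> nat \<Rightarrow> 'o list" where
  "alternating P Q n = map (\<lambda>i. if even i \<longleftrightarrow> even n then P i else Q i) (rev [0..<n])"

lemma alternating_Suc: "alternating P Q (Suc n) = Q n # alternating Q P n"
  by (auto simp: alternating_def)

lemma set_alternating:
  assumes "\<And>i. i < n \<Longrightarrow> R (P i)" "\<And>i. i < n \<Longrightarrow> R (Q i)" "X \<in> set (alternating P Q n)"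
  shows "R X"
  using assms by (auto simp: alternating_def)

context abelian_category
begin

lemma generalized_Schanuel:
  assumes "\<And>i. i < n \<Longrightarrow> short_exact C (S (Suc i)) (P i) (S i)"
    and "\<And>i. i < n \<Longrightarrow> short_exact C (T (Suc i)) (Q i) (T i)"
    and "\<And>i. i < n \<Longrightarrow> projective C (P i)"
    and "\<And>i. i < n \<Longrightarrow> projective C (Q i)"
    and "isomorphic C (S 0) (T 0)"
  shows "isomorphic C (direct_sum C (S n # alternating P Q n)) (direct_sum C (T n # alternating Q P n))"
  using assms(1-4)
proof (induction n)
  case 0
  then show ?case using assms(5) by (simp add: alternating_def)
next
  case (Suc n)
  let ?E = "alternating P Q n" and ?F = "alternating Q P n"
  have proj: "projective C X" if "X \<in> set ?E \<union> set ?F" for X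
    using that set_alternating [where R = "projective C" and n = n] Suc.prems(3,4) by (metis Un_iff less_Suc_eq)
  then have EF: "set ?E \<subseteq> Obj C" "set ?F \<subseteq> Obj C" by (auto simp: projective_def)
  have PQ: "projective C (P n)" "projective C (Q n)" using Suc.prems by simp_all
  then have PQ_Obj: "P n \<in> Obj C" "Q n \<in> Obj C" by (auto simp: projective_def)
  have se: "short_exact C (S (Suc n)) (P n) (S n)" "short_exact C (T (Suc n)) (Q n) (T n)"
    using Suc.prems by simp_all
  then have ST_Obj: "S n \<in> Obj C" "S (Suc n) \<in> Obj C" "T n \<in> Obj C" "T (Suc n) \<in> Obj C"
    unfolding short_exact_def by (metis Dom_closed Cod_closed is_kernelD(1,2))+
  have "short_exact C (S (Suc n)) (direct_sum C (P n # ?E)) (direct_sum C (S n # ?E))"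
    by (rule short_exact_add_summand [OF se(1) direct_sum_Cons direct_sum_Cons]) (fact PQ_Obj ST_Obj EF)+
  moreover have "isomorphic C (direct_sum C (S n # ?E)) (direct_sum C (T n # ?F))"
    by (rule Suc.IH) (use Suc.prems in auto)
  ultimately have S: "short_exact C (S (Suc n)) (direct_sum C (P n # ?E)) (direct_sum C (T n # ?F))"
    by (rule short_exact_isomorphic)
  have T: "short_exact C (T (Suc n)) (direct_sum C (Q n # ?F)) (direct_sum C (T n # ?F))"
    by (rule short_exact_add_summand [OF se(2) direct_sum_Cons direct_sum_Cons]) (fact PQ_Obj ST_Obj EF)+
  show ?case
    unfolding alternating_Suc
    by (rule Schanuel [OF S T]; (rule projective_direct_sum direct_sum_Cons)?)
      (use proj PQ PQ_Obj ST_Obj EF in auto)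
qed

text \<open>
  Factor the \<open>j\<close>-th arrow through its image as \<open>m j \<cdot> e j\<close>. By exactness \<open>m j\<close> is the kernel of the
  next arrow \<open>m (j+1) \<cdot> e (j+1)\<close>, hence of the epimorphism \<open>e (j+1)\<close>. The list starts at the left
  end, so \<open>P i\<close> stands at position \<open>n + 1 - i\<close> and the syzygy \<open>S i\<close> is the image number
  \<open>n + 1 - i\<close>. At the right end the image is the kernel of the zero arrow out of \<open>A\<close>; at the left
  end \<open>e 1\<close> is an epimorphism out of \<open>K\<close> whose kernel \<open>m 0\<close> is zero.
\<close>
lemma exact_sequence_syzygies:
  assumes "zero_object C Z" "exact_sequence C ([Z, K] @ map P (rev [0..<n]) @ [A, Z]) fs"
  obtains S where "\<And>i. i < n \<Longrightarrow> short_exact C (S (Suc i)) (P i) (S i)"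
    "isomorphic C (S 0) A" "isomorphic C (S n) K"
proof -
  define X where "X = [Z, K] @ map P (rev [0..<n]) @ [A, Z]"
  have len: "length fs = n + 3"
    and fs: "\<And>j. j < n + 3 \<Longrightarrow> fs ! j \<in> Arr C \<and> Dom C (fs ! j) = X ! j \<and> Cod C (fs ! j) = X ! Suc j"
    and ex: "\<And>j. j \<le> Suc n \<Longrightarrow> exact_at C (fs ! j) (fs ! Suc j)"
    using assms(2) by (auto simp: exact_sequence_def X_def homset_def)
  have X0: "X ! 0 = Z" "X ! 1 = K" "X ! (n + 2) = A" "X ! (n + 3) = Z"
    by (simp_all add: X_def nth_append)
  have XP: "X ! (Suc n - i) = P i" if "i < n" for i
  proof -
    have "Suc n - i = Suc (Suc (n - Suc i))" using that by simp
    then show ?thesis using that by (simp add: X_def nth_append rev_nth)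
  qed
  have "\<exists>m e. is_kernel C (fs ! Suc j) m \<and> epic C e \<and> Dom C e = X ! j \<and> Cod C e = Dom C m \<and> m \<cdot> e = fs ! j"
    if j: "j \<le> Suc n" for j
  proof -
    obtain m where m: "is_image C (fs ! j) m" "is_kernel C (fs ! Suc j) m"
      using ex [OF j] by (auto simp: exact_at_def)
    obtain e where "epic C e" "Dom C e = Dom C (fs ! j)" "Cod C e = Dom C m" "m \<cdot> e = fs ! j"
      by (rule image_factorization [OF m(1)])
    with m(2) fs [of j] j show ?thesis by auto
  qed
  then obtain m e where m: "\<And>j. j \<le> Suc n \<Longrightarrow> is_kernel C (fs ! Suc j) (m j)"
    and e: "\<And>j. j \<le> Suc n \<Longrightarrow> epic C (e j)"
    and De: "\<And>j. j \<le> Suc n \<Longrightarrow> Dom C (e j) = X ! j"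
    and Ce: "\<And>j. j \<le> Suc n \<Longrightarrow> Cod C (e j) = Dom C (m j)"
    and me: "\<And>j. j \<le> Suc n \<Longrightarrow> m j \<cdot> e j = fs ! j"
    by metis
  have ker: "is_kernel C (e (Suc j)) (m j)" if "j \<le> n" for j
  proof (rule is_kernel_monic_Cmp)
    show "is_kernel C (m (Suc j) \<cdot> e (Suc j)) (m j)" using m [of j] me [of "Suc j"] that by simp
    show "monic C (m (Suc j))" using m [of "Suc j"] that by (simp add: is_kernel_monic)
    show "e (Suc j) \<in> Arr C" using e [of "Suc j"] that by (simp add: epic_def)
    show "Dom C (m (Suc j)) = Cod C (e (Suc j))" using Ce [of "Suc j"] that by simp
  qed
  show thesis
  proof (rule that [of "\<lambda>i. Dom C (m (Suc n - i))"])
    fix i assume i: "i < n"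
    then have "Suc n - i = Suc (Suc n - Suc i)" by simp
    with i ker [of "Suc n - Suc i"] e [of "Suc n - i"] De [of "Suc n - i"] Ce [of "Suc n - i"] XP [of i]
    show "short_exact C (Dom C (m (Suc n - Suc i))) (P i) (Dom C (m (Suc n - i)))"
      unfolding short_exact_def by auto
  next
    have "fs ! (n + 2) = Zer C (Dom C (fs ! (n + 2))) (Cod C (fs ! (n + 2)))"
      by (rule zero_object_arr [OF assms(1)]) (use fs [of "n + 2"] X0 in \<open>simp_all add: numeral_3_eq_3\<close>)
    with m [of "Suc n"] have "isomorphic C (Dom C (m (Suc n))) (Dom C (fs ! (n + 2)))"
      by (intro is_kernel_of_zero) simp_all
    then show "isomorphic C (Dom C (m (Suc n - 0))) A"
      using fs [of "n + 2"] X0 by simp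
  next
    have m0 [simp]: "m 0 \<in> Arr C" and e0 [simp]: "e 0 \<in> Arr C" "Dom C (e 0) = Z" "Cod C (e 0) = Dom C (m 0)"
      using is_kernelD(2) [OF m [of 0]] e [of 0] De [of 0] Ce [of 0] X0 by (auto simp: epic_def)
    have Z [simp]: "Z \<in> Obj C" using assms(1) by (simp add: zero_object_def)
    \<comment> \<open>An epimorphism out of a zero object has zero target, so \<open>m 0\<close> vanishes.\<close>
    have "m 0 \<cdot> e 0 = Zer C Z (Cod C (m 0))"
      using zero_object_arr [OF assms(1), of "m 0 \<cdot> e 0"] by simp
    then have "m 0 \<cdot> e 0 = Zer C (Dom C (m 0)) (Cod C (m 0)) \<cdot> e 0" by simp
    then have "m 0 = Zer C (Dom C (m 0)) (Cod C (m 0))"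
      by (rule epicD [OF e [OF le0]]) simp_all
    then have "isomorphic C (Dom C (e 1)) (Cod C (e 1))"
      using epic_with_zero_kernel [OF e ker [of 0]] by simp
    then show "isomorphic C (Dom C (m (Suc n - n))) K"
      using De [of 1] Ce [of 1] X0 by (auto intro: isomorphic_sym)
  qed
qed

end

theorem mainTheorem9:
  fixes C :: "('o, 'm, 'x) add_cat_scheme"
    and A K L Z :: 'o
    and P Q :: "nat \<Rightarrow> 'o"
    and n :: nat
    and fs gs :: "'m list"
  assumes "abelian_category C"
    and "A \<in> Obj C"
    and "zero_object C Z"
    and "exact_sequence C ([Z, K] @ map P (rev [0..<n]) @ [A, Z]) fs"
    and "exact_sequence C ([Z, L] @ map Q (rev [0..<n]) @ [A, Z]) gs"
    and "\<And>i. i < n \<Longrightarrow> projective C (P i)"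
    and "\<And>i. i < n \<Longrightarrow> projective C (Q i)"
  shows
    "(even n \<longrightarrow>
        isomorphic C
          (direct_sum C (K # map (\<lambda>i. if even i then P i else Q i) (rev [0..<n])))
          (direct_sum C (L # map (\<lambda>i. if even i then Q i else P i) (rev [0..<n])))) \<and>
     (odd n \<longrightarrow>
        isomorphic C
          (direct_sum C (K # map (\<lambda>i. if even i then Q i else P i) (rev [0..<n])))
          (direct_sum C (L # map (\<lambda>i. if even i then P i else Q i) (rev [0..<n]))))"
proof -
  interpret abelian_category C by fact
  obtain S where S: "\<And>i. i < n \<Longrightarrow> short_exact C (S (Suc i)) (P i) (S i)"
    "isomorphic C (S 0) A" "isomorphic C (S n) K"
    using exact_sequence_syzygies [OF assms(3,4)] by blast
  obtain T where T: "\<And>i. i < n \<Longrightarrow> short_exact C (T (Suc i)) (Q i) (T i)"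
    "isomorphic C (T 0) A" "isomorphic C (T n) L"
    using exact_sequence_syzygies [OF assms(3,5)] by blast
  have Obj: "set (alternating P Q n) \<subseteq> Obj C" "set (alternating Q P n) \<subseteq> Obj C"
    using assms(6,7) by (auto simp: projective_def alternating_def)
  have "isomorphic C (direct_sum C (S n # alternating P Q n)) (direct_sum C (T n # alternating Q P n))"
    using S(2) T(2) by (intro generalized_Schanuel S(1) T(1) assms(6,7))
      (auto intro: isomorphic_trans isomorphic_sym)
  then have "isomorphic C (direct_sum C (K # alternating P Q n)) (direct_sum C (L # alternating Q P n))"
    using isomorphic_direct_sum_Cons [OF S(3) Obj(1)] isomorphic_direct_sum_Cons [OF T(3) Obj(2)]
    by (blast intro: isomorphic_trans isomorphic_sym)
  moreover have "alternating P Q n = map (\<lambda>i. if even i then P i else Q i) (rev [0..<n])"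
    "alternating Q P n = map (\<lambda>i. if even i then Q i else P i) (rev [0..<n])" if "even n"
    using that by (simp_all add: alternating_def)
  moreover have "alternating P Q n = map (\<lambda>i. if even i then Q i else P i) (rev [0..<n])"
    "alternating Q P n = map (\<lambda>i. if even i then P i else Q i) (rev [0..<n])" if "odd n"
    using that by (auto simp: alternating_def)
  ultimately show ?thesis by metis
qed

end
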